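(* Let $\mathbb{F}$ be a field of characteristic $0$, let $Z=\{P_1,\dots,P_r\}$ be a set of $r$ distinct points in $\mathbb{P}^n$ over $\mathbb{F}$, and let $d,m$ be positive integers with $\binom{d+n}{n}=\binom{m+n-1}{n}+r+1$. Let $F(a_0,\dots,a_n,x_0,\dots,x_n)=\det M$, where $M$ is the interpolation matrix of $(Z,d,m)$. Let $B=(b_0,\dots,b_n)\in\mathbb{P}^n$ and define homogeneous polynomials in $\mathbb{F}[x_0,\dots,x_n]$ by $$F_L:=F(b_0,\dots,b_n,x_0,\dots,x_n),\qquad F_R:=F(x_0,\dots,x_n,b_0,\dots,b_n).$$ If $F_L$ is nonzero and has multiplicity exactly $m$ at $B$, then $F_L$ and $F_R$ both have multiplicity $m$ at $B$, and the tangent cones of $F_L=0$ and $F_R=0$ at $B$ are equal.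
   Context: Interpolation matrix. Fix coordinates $(p_{i0},\dots,p_{in})$ of each $P_i$. Let $w=w(a_0,\dots,a_n)$ be the row vector of all $\binom{d+n}{n}$ monomials of degree $d$ in $a_0,\dots,a_n$, in some fixed order. For a tuple $Q=(q_0,\dots,q_n)$, $w(Q)$ denotes $w$ with $q_i$ substituted for $a_i$. The interpolation matrix $M$ is the square matrix of size $\binom{d+n}{n}$ with entries in $\mathbb{F}[a_0,\dots,a_n,x_0,\dots,x_n]$ whose rows are, in order: the $\binom{m+n-1}{n}$ rows $\frac{\partial^{m-1}}{\partial a_0^{t_0}\cdots\partial a_n^{t_n}}w$ for all $(t_0,\dots,t_n)\in\mathbb{Z}_{\ge0}^{n+1}$ with $t_0+\cdots+t_n=m-1$ (derivatives taken entrywise, in some fixed order); then the $r$ rows $w(P_1),\dots,w(P_r)$; and finally the row $w(x_0,\dots,x_n)$. Tangent cone. For a nonzero homogeneous polynomial $H(x_0,\dots,x_n)$ with multiplicity $m$ at a point $X\in\mathbb{P}^n$, the tangent cone of $H=0$ at $X$ is given by the equation $$\sum_{j_0+\cdots+j_n=m}\frac{1}{j_0!\cdots j_n!}\,\frac{\partial^m H}{\partial x_0^{j_0}\cdots\partial x_n^{j_n}}(X)\,x_0^{j_0}\cdots x_n^{j_n}=0.$$ *)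

theory Defs
  imports
    "HOL-Library.Poly_Mapping"
    "HOL-Library.Cardinality"
    "Jordan_Normal_Form.Determinant"
begin

section \<open>Multivariate polynomials\<close>

text \<open>
  Polynomials over \<open>'a\<close> in the variables \<open>'v\<close> are finitely supported functions from exponent
  vectors to coefficients.  With \<open>'n\<close> a type of \<open>n + 1\<close> elements, the ring
  F[x_0, ..., x_n] is \<open>('n, 'a) mpoly\<close> and F[a_0, ..., a_n, x_0, ..., x_n] is
  \<open>('n + 'n, 'a) mpoly\<close>, with \<open>Inl i\<close> standing for a_i and \<open>Inr i\<close> for x_i.
\<close>

type_synonym ('v, 'a) mpoly = "('v \<Rightarrow>\<^sub>0 nat) \<Rightarrow>\<^sub>0 'a"

definition mp_const :: "'a \<Rightarrow> ('v, 'a::zero) mpoly" where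
  "mp_const c = Poly_Mapping.single 0 c"

definition mp_var :: "'v \<Rightarrow> ('v, 'a::zero_neq_one) mpoly" where
  "mp_var v = Poly_Mapping.single (Poly_Mapping.single v 1) 1"

definition mp_eval :: "('v::finite \<Rightarrow> 'a) \<Rightarrow> ('v, 'a::comm_ring_1) mpoly \<Rightarrow> 'a" where
  "mp_eval x p =
     (\<Sum>e\<in>Poly_Mapping.keys p. Poly_Mapping.lookup p e * (\<Prod>v\<in>UNIV. x v ^ Poly_Mapping.lookup e v))"

definition mp_subst ::
  "('v::finite \<Rightarrow> ('w, 'a) mpoly) \<Rightarrow> ('v, 'a::comm_ring_1) mpoly \<Rightarrow> ('w, 'a) mpoly" where
  "mp_subst s p =
     (\<Sum>e\<in>Poly_Mapping.keys p.
        mp_const (Poly_Mapping.lookup p e) * (\<Prod>v\<in>UNIV. s v ^ Poly_Mapping.lookup e v))"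

text \<open>
  Formal partial derivative.  The truncated subtraction is harmless: if the exponent of \<open>v\<close> is
  \<open>0\<close>, the coefficient vanishes.
\<close>

definition pderiv_var :: "'v \<Rightarrow> ('v, 'a::comm_ring_1) mpoly \<Rightarrow> ('v, 'a) mpoly" where
  "pderiv_var v p =
     (\<Sum>e\<in>Poly_Mapping.keys p.
        Poly_Mapping.single (e - Poly_Mapping.single v 1)
          (of_nat (Poly_Mapping.lookup e v) * Poly_Mapping.lookup p e))"

text \<open>
  Multi-indices are functions \<open>'v \<Rightarrow> nat\<close>.  The iterated partial derivative applies
  \<open>pderiv_var v\<close> exactly \<open>t v\<close> times for each variable \<open>v\<close>; the order is irrelevant because
  the operators commute, see \<open>pderiv_multi_0\<close> and \<open>pderiv_multi_Suc\<close> below.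
\<close>

definition pderiv_multi ::
  "('v::finite \<Rightarrow> nat) \<Rightarrow> ('v, 'a::comm_ring_1) mpoly \<Rightarrow> ('v, 'a) mpoly" where
  "pderiv_multi t p = Finite_Set.fold (\<lambda>v. pderiv_var v ^^ t v) p UNIV"

lemma lookup_pderiv_var:
  "Poly_Mapping.lookup (pderiv_var v p) e =
     of_nat (Suc (Poly_Mapping.lookup e v)) * Poly_Mapping.lookup p (e + Poly_Mapping.single v 1)"
proof -
  let ?s = "Poly_Mapping.single v (1::nat)"
  have eq: "(of_nat (Poly_Mapping.lookup k v) * Poly_Mapping.lookup p k when k - ?s = e) =
      (of_nat (Poly_Mapping.lookup k v) * Poly_Mapping.lookup p k when k = e + ?s)" for k
  proof (cases "Poly_Mapping.lookup k v = 0")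
    case False
    have "k - ?s + ?s = k"
      by (rule poly_mapping_eqI)
        (use False in \<open>auto simp: lookup_add lookup_minus lookup_single when_def\<close>)
    then have "k - ?s = e \<longleftrightarrow> k = e + ?s" by (metis add_diff_cancel_right')
    then show ?thesis by simp
  qed simp
  have "Poly_Mapping.lookup (pderiv_var v p) e =
    (\<Sum>k\<in>Poly_Mapping.keys p.
       of_nat (Poly_Mapping.lookup k v) * Poly_Mapping.lookup p k when k = e + ?s)"
    by (simp only: pderiv_var_def lookup_sum lookup_single eq)
  also have "\<dots> = of_nat (Suc (Poly_Mapping.lookup e v)) * Poly_Mapping.lookup p (e + ?s)"
    by (simp add: when_def lookup_add in_keys_iff)
  finally show ?thesis .
qed

lemma pderiv_var_commute:
  fixes p :: "('v, 'a::comm_ring_1) mpoly"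
  shows "pderiv_var w (pderiv_var v p) = pderiv_var v (pderiv_var w p)"
  by (rule poly_mapping_eqI, cases "v = w")
    (simp_all add: lookup_pderiv_var lookup_add lookup_single ac_simps)

lemma comp_fun_commute_pderiv_var_funpow:
  "comp_fun_commute (\<lambda>v. (pderiv_var v :: ('v, 'a::comm_ring_1) mpoly \<Rightarrow> _) ^^ t v)"
  by (rule comp_fun_commute.comp_fun_commute_funpow)
    (simp add: comp_fun_commute_def' comp_fun_commute_on_def fun_eq_iff pderiv_var_commute)

lemma pderiv_multi_0: "pderiv_multi (\<lambda>_. 0) p = p"
proof -
  interpret comp_fun_commute "\<lambda>(v::'a) (q :: ('a, 'b) mpoly). q"
    by standard auto
  have "Finite_Set.fold (\<lambda>v q. q) p A = p" if "finite A" for A :: "'a set"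
    using that by induction auto
  then show ?thesis by (simp add: pderiv_multi_def id_def)
qed

lemma pderiv_multi_Suc:
  "pderiv_multi (t(v := Suc (t v))) p = pderiv_var v (pderiv_multi t p)"
proof -
  define s where "s = t(v := Suc (t v))"
  have s: "s v = Suc (t v)" "w \<noteq> v \<Longrightarrow> s w = t w" for w
    by (simp_all add: s_def)
  interpret A: comp_fun_commute "\<lambda>v. pderiv_var v ^^ t v"
    by (rule comp_fun_commute_pderiv_var_funpow)
  interpret B: comp_fun_commute "\<lambda>v. pderiv_var v ^^ s v"
    by (rule comp_fun_commute_pderiv_var_funpow)
  have eq: "Finite_Set.fold (\<lambda>v. pderiv_var v ^^ s v) p A =
      Finite_Set.fold (\<lambda>v. pderiv_var v ^^ t v) p A" if "finite A" "v \<notin> A" for A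
    using that by induction (auto simp: s)
  show ?thesis
    unfolding pderiv_multi_def s_def[symmetric]
    using A.fold_rec[of UNIV v p] B.fold_rec[of UNIV v p] eq[of "UNIV - {v}"]
    by (simp add: s)
qed

section \<open>Projective space, multiplicity, tangent cones\<close>

definition proj_rel :: "(('n \<Rightarrow> 'a::field) \<times> ('n \<Rightarrow> 'a)) set" where
  "proj_rel = {(u, v). (\<exists>i. u i \<noteq> 0) \<and> (\<exists>c. c \<noteq> 0 \<and> v = (\<lambda>i. c * u i))}"

text \<open>
  A point is the set of all its homogeneous coordinate vectors; with \<open>CARD('n) = n + 1\<close> this
  is the projective space of dimension \<open>n\<close>.
\<close>

definition projective_space :: "('n::finite \<Rightarrow> 'a::field) set set" where
  "projective_space = {u. \<exists>i. u i \<noteq> 0} // proj_rel"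

text \<open>
  In the next definitions \<open>X\<close> is a vector of homogeneous coordinates of the point and the
  polynomial is meant to be homogeneous over a field of characteristic \<open>0\<close>.  Multiplicity \<open>m\<close>
  then says that the Taylor expansion at \<open>X\<close> starts in degree \<open>m\<close>.  In particular the
  polynomial is not zero.
\<close>

definition has_multiplicity ::
  "('n::finite, 'a::field_char_0) mpoly \<Rightarrow> ('n \<Rightarrow> 'a) \<Rightarrow> nat \<Rightarrow> bool" where
  "has_multiplicity H X m \<longleftrightarrow>
     (\<forall>j. sum j UNIV < m \<longrightarrow> mp_eval X (pderiv_multi j H) = 0) \<and>
     (\<exists>j. sum j UNIV = m \<and> mp_eval X (pderiv_multi j H) \<noteq> 0)"

definition tangent_form ::
  "nat \<Rightarrow> ('n::finite, 'a::field_char_0) mpoly \<Rightarrow> ('n \<Rightarrow> 'a) \<Rightarrow> ('n, 'a) mpoly" where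
  "tangent_form m H X =
     (\<Sum>j | sum j UNIV = m.
        mp_const (1 / (\<Prod>i\<in>UNIV. fact (j i)) * mp_eval X (pderiv_multi j H)) *
        (\<Prod>i\<in>UNIV. mp_var i ^ j i))"

text \<open>
  The hypersurface \<open>G = 0\<close>, as a closed subscheme, is represented by the principal ideal
  generated by \<open>G\<close>.  Equality of hypersurfaces thus takes multiplicities of components into
  account and does not depend on which points are rational over the ground field.
\<close>

definition hypersurface :: "('n, 'a::field) mpoly \<Rightarrow> ('n, 'a) mpoly set" where
  "hypersurface G = {H. G dvd H}"

definition tangent_cone ::
  "nat \<Rightarrow> ('n::finite, 'a::field_char_0) mpoly \<Rightarrow> ('n \<Rightarrow> 'a) \<Rightarrow> ('n, 'a) mpoly set" where
  "tangent_cone m H X = hypersurface (tangent_form m H X)"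

section \<open>The interpolation matrix\<close>

text \<open>
  A list \<open>es\<close> with \<open>enumerates_multi_indices k es\<close> fixes an order on the exponents of the
  monomials of degree \<open>k\<close>, or on the partial derivatives of order \<open>k\<close>.
\<close>

definition enumerates_multi_indices :: "nat \<Rightarrow> ('n::finite \<Rightarrow> nat) list \<Rightarrow> bool" where
  "enumerates_multi_indices k es \<longleftrightarrow> distinct es \<and> set es = {e. sum e UNIV = k}"

definition monomial_row :: "('n::finite \<Rightarrow> nat) list \<Rightarrow> ('n \<Rightarrow> 'b::comm_ring_1) \<Rightarrow> 'b vec" where
  "monomial_row es q = vec (length es) (\<lambda>k. \<Prod>i\<in>UNIV. q i ^ (es ! k) i)"

text \<open>
  Arguments: the order \<open>es\<close> of the monomials, the order \<open>ts\<close> of the derivatives, the number \<open>r\<close>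
  of points, and the coordinate vectors \<open>p 1, \<dots>, p r\<close>.
\<close>

definition interpolation_matrix ::
  "('n::finite \<Rightarrow> nat) list \<Rightarrow> ('n \<Rightarrow> nat) list \<Rightarrow> nat \<Rightarrow> (nat \<Rightarrow> 'n \<Rightarrow> 'a::field_char_0) \<Rightarrow>
     ('n + 'n, 'a) mpoly mat" where
  "interpolation_matrix es ts r p = mat_of_rows (length es)
     (map (\<lambda>t. map_vec (pderiv_multi (case_sum t (\<lambda>_. 0)))
                (monomial_row es (\<lambda>i. mp_var (Inl i)))) ts
      @ map (\<lambda>k. monomial_row es (\<lambda>i. mp_const (p k i))) [1..<r + 1]
      @ [monomial_row es (\<lambda>i. mp_var (Inr i))])"

end

(*
  Write a = b + u y and x = b + v y with parameters u, v.  Expanding the determinant along its last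
  row shows that F(a, x) is, for fixed a, a form of degree d in x whose derivatives of order m - 1
  vanish at x = a (a determinant with two equal rows).  By Euler's formula all lower derivatives
  vanish there too, so (v - u)^m divides F(b + u y, b + v y).  The lowest-order terms of F_L and F_R
  at B are obtained by setting u = 0 and v = 0; hence they differ only by the factor (-1)^m.
*)

theory Submission
  imports Defs "Jordan_Normal_Form.Char_Poly"
begin

section \<open>Evaluation of polynomials along ring homomorphisms\<close>

text \<open>The matrix controls only derivatives of order \<open>m - 1\<close>, and descending to a
  lower order \<open>k\<close> by Euler's formula costs a division by \<open>d - k\<close>. The
  dimension count makes this possible: it forces \<open>m \<le> d\<close>. The parameters u and v
  stay independent until the power of v - u is split off; only then is there a single cofactor,
  shared by both specializations, whose constant term gives both leading forms at y. Treating one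
  direction y at a time loses nothing, since a field of characteristic 0 is infinite and a
  polynomial is determined by its values. Divisibility alone bounds both multiplicities from below;
  the exact multiplicity of \<open>F\<^sub>L\<close> says that the leading form is nonzero.\<close>

text \<open>One notion for four uses: evaluation (\<open>h\<close> the identity), substitution
  (\<open>mp_const\<close>), restriction to a line (\<open>[:c:]\<close>) and to the plane of the
  two parameters (\<open>[:[:c:]:]\<close>).\<close>

definition eval_hom ::
  "('a \<Rightarrow> 'b) \<Rightarrow> ('v::finite \<Rightarrow> 'b) \<Rightarrow> ('v, 'a::comm_ring_1) mpoly \<Rightarrow> 'b::comm_ring_1" where
  "eval_hom h x p =
     (\<Sum>e\<in>Poly_Mapping.keys p. h (Poly_Mapping.lookup p e) * (\<Prod>v\<in>UNIV. x v ^ Poly_Mapping.lookup e v))"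

lemma mp_eval_eq_eval_hom: "mp_eval x = eval_hom (\<lambda>c. c) x"
  by (simp add: fun_eq_iff mp_eval_def eval_hom_def)

lemma mp_subst_eq_eval_hom: "mp_subst s = eval_hom mp_const s"
  by (simp add: fun_eq_iff mp_subst_def eval_hom_def)

lemma poly_mapping_sum_single:
  "(\<Sum>e\<in>Poly_Mapping.keys p. Poly_Mapping.single e (Poly_Mapping.lookup p e)) = p"
  by (rule poly_mapping_eqI) (auto simp: lookup_sum lookup_single when_def in_keys_iff)

context comm_ring_hom
begin

lemma eval_hom_superset:
  assumes "finite A" "Poly_Mapping.keys p \<subseteq> A"
  shows "eval_hom hom x p = (\<Sum>e\<in>A. hom (Poly_Mapping.lookup p e) * (\<Prod>v\<in>UNIV. x v ^ Poly_Mapping.lookup e v))"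
  unfolding eval_hom_def
  by (rule sum.mono_neutral_left) (use assms in \<open>auto simp: in_keys_iff\<close>)

lemma eval_hom_single:
  "eval_hom hom x (Poly_Mapping.single e c) = hom c * (\<Prod>v\<in>UNIV. x v ^ Poly_Mapping.lookup e v)"
  by (subst eval_hom_superset[where A = "{e}"]) auto

lemma eval_hom_add: "eval_hom hom x (p + q) = eval_hom hom x p + eval_hom hom x q"
proof -
  let ?A = "Poly_Mapping.keys p \<union> Poly_Mapping.keys q"
  have "Poly_Mapping.keys (p + q) \<subseteq> ?A" by (rule Poly_Mapping.keys_add)
  then show ?thesis
    by (simp add: eval_hom_superset[where A = ?A] lookup_add hom_add sum.distrib algebra_simps)
qed

lemma eval_hom_zero: "eval_hom hom x 0 = 0"
  by (simp add: eval_hom_def)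

lemma eval_hom_sum: "eval_hom hom x (sum f A) = (\<Sum>a\<in>A. eval_hom hom x (f a))"
  by (induction A rule: infinite_finite_induct) (simp_all add: eval_hom_zero eval_hom_add)

lemma eval_hom_mult: "eval_hom hom x (p * q) = eval_hom hom x p * eval_hom hom x q"
proof -
  let ?S = "Poly_Mapping.single" and ?l = "Poly_Mapping.lookup"
  have "p * q = (\<Sum>e\<in>Poly_Mapping.keys p. ?S e (?l p e)) * (\<Sum>e\<in>Poly_Mapping.keys q. ?S e (?l q e))"
    by (simp only: poly_mapping_sum_single)
  also have "\<dots> = (\<Sum>e\<in>Poly_Mapping.keys p. \<Sum>e'\<in>Poly_Mapping.keys q. ?S (e + e') (?l p e * ?l q e'))"
    by (simp add: sum_product mult_single)
  also have "eval_hom hom x \<dots> = eval_hom hom x p * eval_hom hom x q"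
    by (simp add: eval_hom_sum eval_hom_single eval_hom_def[of _ _ p] eval_hom_def[of _ _ q]
        sum_product lookup_add power_add prod.distrib hom_mult algebra_simps)
  finally show ?thesis .
qed

lemma eval_hom_const: "eval_hom hom x (mp_const c) = hom c"
  by (simp add: mp_const_def eval_hom_single)

lemma eval_hom_var: "eval_hom hom x (mp_var v) = x v"
proof -
  have "(\<Prod>w\<in>UNIV. x w ^ Poly_Mapping.lookup (Poly_Mapping.single v (1::nat)) w)
      = (\<Prod>w\<in>UNIV. if w = v then x w else 1)"
    by (rule prod.cong) (auto simp: lookup_single)
  then show ?thesis by (simp add: mp_var_def eval_hom_single)
qed

lemma comm_ring_hom_eval_hom: "comm_ring_hom (eval_hom hom x)"
proof
  show "eval_hom hom x 1 = 1"
    using eval_hom_const[of x 1] by (simp add: mp_const_def)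
qed (simp_all add: eval_hom_add eval_hom_mult eval_hom_zero)

end

lemma comm_ring_hom_id: "comm_ring_hom (\<lambda>c :: 'a::comm_ring_1. c)"
  by unfold_locales simp_all

lemma comm_ring_hom_pCons: "comm_ring_hom (\<lambda>c :: 'a::comm_ring_1. [:c:])"
  by unfold_locales simp_all

lemma comm_ring_hom_comp:
  assumes "comm_ring_hom f" "comm_ring_hom g"
  shows "comm_ring_hom (\<lambda>x. f (g x))"
proof -
  interpret f: comm_ring_hom f by fact
  interpret g: comm_ring_hom g by fact
  show ?thesis by unfold_locales (simp_all add: f.hom_add g.hom_add f.hom_mult g.hom_mult)
qed

text \<open>Setting u or v to 0 is itself a ring homomorphism, so by this lemma it can follow the
  two-parameter evaluation.\<close>

lemma hom_eval_hom:
  assumes "comm_ring_hom g"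
  shows "g (eval_hom h x p) = eval_hom (\<lambda>c. g (h c)) (\<lambda>v. g (x v)) p"
proof -
  interpret comm_ring_hom g by fact
  show ?thesis
    by (simp add: eval_hom_def hom_sum hom_mult hom_prod hom_power)
qed

lemma eval_hom_mp_subst:
  assumes "comm_ring_hom h"
  shows "eval_hom h x (mp_subst s p) = eval_hom h (\<lambda>v. eval_hom h x (s v)) p"
proof -
  interpret comm_ring_hom h by fact
  show ?thesis
    unfolding mp_subst_eq_eval_hom
    by (subst hom_eval_hom[OF comm_ring_hom_eval_hom]) (simp add: eval_hom_const)
qed

section \<open>Divided derivatives of monomials\<close>

text \<open>
  The value at \<open>x\<close> of the derivative of order \<open>j\<close>, divided by \<open>j!\<close>, of the monomial with
  exponent \<open>e\<close>.
\<close>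

definition hasse :: "('v::finite \<Rightarrow> nat) \<Rightarrow> ('v \<Rightarrow> nat) \<Rightarrow> ('v \<Rightarrow> 'b) \<Rightarrow> 'b::comm_ring_1" where
  "hasse j e x = (\<Prod>v\<in>UNIV. of_nat (e v choose j v) * x v ^ (e v - j v))"

lemma hasse_eq_0: "e v < j v \<Longrightarrow> hasse j e x = 0"
  unfolding hasse_def by (rule prod_zero) (auto simp: binomial_eq_0 intro!: exI[of _ v])

lemma finite_multi_indices: "finite {j :: 'v::finite \<Rightarrow> nat. sum j UNIV = k}"
proof (rule finite_subset)
  show "{j :: 'v \<Rightarrow> nat. sum j UNIV = k} \<subseteq> (\<Pi>\<^sub>E v\<in>UNIV. {..k})"
    by (auto simp: member_le_sum)
  show "finite (\<Pi>\<^sub>E v\<in>(UNIV :: 'v set). {..k})"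
    by (rule finite_PiE) auto
qed

lemma prod_monom:
  "(\<Prod>v\<in>A. Polynomial.monom (c v) (k v)) = Polynomial.monom (\<Prod>v\<in>A. c v :: 'b::comm_ring_1) (\<Sum>v\<in>A. k v)"
  by (induction A rule: infinite_finite_induct) (simp_all add: mult_monom)

lemma linear_power_eq_sum_monom:
  fixes a b :: "'b::comm_ring_1"
  shows "[:a, b:] ^ n = (\<Sum>i\<le>n. Polynomial.monom (of_nat (n choose i) * a ^ (n - i) * b ^ i) i)"
proof -
  have "[:a, b:] = Polynomial.monom b 1 + [:a:]"
    by (simp add: monom_altdef)
  also have "\<dots> ^ n = (\<Sum>i\<le>n. of_nat (n choose i) * Polynomial.monom b 1 ^ i * [:a:] ^ (n - i))"
    by (rule binomial_ring)
  also have "\<dots> = (\<Sum>i\<le>n. Polynomial.monom (of_nat (n choose i) * a ^ (n - i) * b ^ i) i)"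
    by (simp add: monom_power of_nat_poly poly_const_pow smult_monom ac_simps)
  finally show ?thesis .
qed

text \<open>Taylor expansion of the monomial \<open>e\<close> on the line through \<open>x\<close>
  with direction \<open>y\<close>, from the binomial theorem in each variable.\<close>

lemma coeff_prod_linear_power:
  fixes x y :: "'v::finite \<Rightarrow> 'b::comm_ring_1"
  shows "Polynomial.coeff (\<Prod>v\<in>UNIV. [:x v, y v:] ^ e v) k =
    (\<Sum>j | sum j UNIV = k. hasse j e x * (\<Prod>v\<in>UNIV. y v ^ j v))"
proof -
  let ?P = "\<Pi>\<^sub>E v\<in>UNIV. {..e v}"
  let ?t = "\<lambda>j. hasse j e x * (\<Prod>v\<in>UNIV. y v ^ j v)"
  have fin: "finite ?P" by (rule finite_PiE) auto
  have "(\<Prod>v\<in>UNIV. [:x v, y v:] ^ e v) = (\<Sum>j\<in>?P. Polynomial.monom (?t j) (sum j UNIV))"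
    by (simp add: linear_power_eq_sum_monom prod_sum_PiE prod_monom hasse_def prod.distrib)
  then have "Polynomial.coeff (\<Prod>v\<in>UNIV. [:x v, y v:] ^ e v) k = (\<Sum>j\<in>?P. if sum j UNIV = k then ?t j else 0)"
    by (simp add: coeff_sum)
  also have "\<dots> = (\<Sum>j \<in> ?P \<inter> {j. sum j UNIV = k}. ?t j)"
    using fin by (simp add: sum.inter_restrict)
  \<comment> \<open>The expansion produces only \<open>j\<close> bounded by \<open>e\<close>; the
    other \<open>j\<close> may be added because their divided derivatives are 0.\<close>
  also have "\<dots> = (\<Sum>j | sum j UNIV = k. ?t j)"
  proof (rule sum.mono_neutral_left[OF finite_multi_indices])
    show "\<forall>j\<in>{j. sum j UNIV = k} - ?P \<inter> {j. sum j UNIV = k}. ?t j = 0"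
    proof
      fix j assume "j \<in> {j. sum j UNIV = k} - ?P \<inter> {j. sum j UNIV = k}"
      then obtain v where "e v < j v" by (auto simp: PiE_iff not_le)
      then show "?t j = 0" by (simp add: hasse_eq_0)
    qed
  qed auto
  finally show ?thesis .
qed

section \<open>Euler's formula and vanishing along a line\<close>

text \<open>The identity holds in each variable separately, by absorption for binomial coefficients;
  summing the factors \<open>e v - j v\<close> gives the difference of the total degrees.\<close>

lemma euler_hasse:
  fixes x :: "'v::finite \<Rightarrow> 'b::comm_ring_1"
  shows "(\<Sum>v\<in>UNIV. of_nat (Suc (j v)) * x v * hasse (j(v := Suc (j v))) e x) =
    (of_nat (sum e UNIV) - of_nat (sum j UNIV)) * hasse j e x"
proof -
  have *: "of_nat (Suc k) * z * (of_nat (n choose Suc k) * z ^ (n - Suc k)) =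
      (of_nat n - of_nat k) * (of_nat (n choose k) * z ^ (n - k))" for z :: 'b and n k
  proof (cases "k < n")
    case True
    have "Suc k * (n choose Suc k) = (n - k) * (n choose k)"
      by (simp only: binomial_absorb_comp binomial_absorption)
    then have c: "(of_nat (Suc k) * of_nat (n choose Suc k) :: 'b) = (of_nat n - of_nat k) * of_nat (n choose k)"
      using True by (metis of_nat_mult of_nat_diff less_imp_le)
    have z: "z * z ^ (n - Suc k) = z ^ (n - k)"
      using True by (metis Suc_diff_Suc power_Suc)
    have "of_nat (Suc k) * z * (of_nat (n choose Suc k) * z ^ (n - Suc k)) =
        of_nat (Suc k) * of_nat (n choose Suc k) * (z * z ^ (n - Suc k))"
      by (simp only: ac_simps)
    also have "\<dots> = (of_nat n - of_nat k) * (of_nat (n choose k) * z ^ (n - k))"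
      by (simp only: c z mult.assoc)
    finally show ?thesis .
  next
    \<comment> \<open>For \<open>k = n\<close> the factor \<open>n - k\<close> vanishes, for
      \<open>k > n\<close> both binomials do. The difference is taken in the ring, so nothing is
      truncated.\<close>
    case False
    then show ?thesis by (cases "k = n") (auto simp: binomial_eq_0)
  qed
  have "of_nat (Suc (j v)) * x v * hasse (j(v := Suc (j v))) e x =
      (of_nat (e v) - of_nat (j v)) * hasse j e x" for v
  proof -
    let ?R = "\<Prod>w\<in>UNIV - {v}. of_nat (e w choose j w) * x w ^ (e w - j w)"
    have upd: "hasse (j(v := Suc (j v))) e x = of_nat (e v choose Suc (j v)) * x v ^ (e v - Suc (j v)) * ?R"
      unfolding hasse_def by (subst prod.remove[of _ v]) auto
    have "of_nat (Suc (j v)) * x v * hasse (j(v := Suc (j v))) e x =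
        of_nat (Suc (j v)) * x v * (of_nat (e v choose Suc (j v)) * x v ^ (e v - Suc (j v))) * ?R"
      by (simp only: upd mult.assoc)
    also have "\<dots> = (of_nat (e v) - of_nat (j v)) * (of_nat (e v choose j v) * x v ^ (e v - j v) * ?R)"
      by (subst *) (simp only: mult.assoc)
    also have "of_nat (e v choose j v) * x v ^ (e v - j v) * ?R = hasse j e x"
      unfolding hasse_def by (subst prod.remove[of UNIV v]) auto
    finally show ?thesis .
  qed
  then show ?thesis
    by (simp only: sum_distrib_right[symmetric] sum_subtractf of_nat_sum)
qed

lemma sum_fun_upd_Suc:
  fixes j :: "'v::finite \<Rightarrow> nat"
  shows "sum (j(v := Suc (j v))) UNIV = Suc (sum j UNIV)"
proof -
  have "sum (j(v := Suc (j v))) UNIV = (\<Sum>w\<in>UNIV. j w + (if w = v then 1 else 0))"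
    by (rule sum.cong) auto
  then show ?thesis by (simp add: sum.distrib)
qed

text \<open>
  Euler's formula expresses each derivative of order \<open>k\<close> at \<open>a\<close>, up to the factor \<open>d - k\<close>, through
  those of order \<open>k + 1\<close>.  The factor is nonzero for \<open>k < N \<le> d\<close>.
\<close>

lemma hasse_vanish_lower:
  fixes a :: "'v::finite \<Rightarrow> 'b::{idom,ring_char_0}"
  assumes deg: "\<And>k. k \<in> K \<Longrightarrow> sum (e k) UNIV = d" and "N \<le> d"
    and top: "\<And>t. sum t UNIV = N \<Longrightarrow> (\<Sum>k\<in>K. c k * hasse t (e k) a) = 0"
    and "sum t UNIV \<le> N"
  shows "(\<Sum>k\<in>K. c k * hasse t (e k) a) = 0"
  using \<open>sum t UNIV \<le> N\<close>
proof (induction "N - sum t UNIV" arbitrary: t)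
  case 0
  then show ?case using top by simp
next
  case (Suc q)
  let ?D = "of_nat d - of_nat (sum t UNIV) :: 'b"
  have IH: "(\<Sum>k\<in>K. c k * hasse (t(v := Suc (t v))) (e k) a) = 0" for v
  proof (rule Suc.hyps(1))
    show "q = N - sum (t(v := Suc (t v))) UNIV" "sum (t(v := Suc (t v))) UNIV \<le> N"
      using Suc.hyps(2) unfolding sum_fun_upd_Suc by linarith+
  qed
  have "?D * (\<Sum>k\<in>K. c k * hasse t (e k) a) = (\<Sum>k\<in>K. c k * (?D * hasse t (e k) a))"
    unfolding sum_distrib_left by (intro sum.cong refl mult.left_commute)
  also have "\<dots> = (\<Sum>k\<in>K. c k * (\<Sum>v\<in>UNIV. of_nat (Suc (t v)) * a v * hasse (t(v := Suc (t v))) (e k) a))"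
    by (rule sum.cong[OF refl], subst euler_hasse) (simp only: deg)
  also have "\<dots> = (\<Sum>k\<in>K. \<Sum>v\<in>UNIV. of_nat (Suc (t v)) * a v * (c k * hasse (t(v := Suc (t v))) (e k) a))"
    unfolding sum_distrib_left by (intro sum.cong refl mult.left_commute)
  also have "\<dots> = (\<Sum>v\<in>UNIV. of_nat (Suc (t v)) * a v * (\<Sum>k\<in>K. c k * hasse (t(v := Suc (t v))) (e k) a))"
    by (subst sum.swap) (simp only: sum_distrib_left)
  also have "\<dots> = 0"
    by (simp only: IH mult_zero_right sum.neutral_const)
  finally have "?D * (\<Sum>k\<in>K. c k * hasse t (e k) a) = 0" .
  moreover have "?D \<noteq> 0"
    using Suc.hyps(2) \<open>N \<le> d\<close> by (auto simp del: of_nat_sum)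
  ultimately show ?case by simp
qed

lemma power_dvd_form_on_line:
  fixes a y :: "'v::finite \<Rightarrow> 'b::{idom,ring_char_0}"
  assumes deg: "\<And>k. k \<in> K \<Longrightarrow> sum (e k) UNIV = d" and "N \<le> d"
    and top: "\<And>t. sum t UNIV = N \<Longrightarrow> (\<Sum>k\<in>K. c k * hasse t (e k) a) = 0"
  shows "s ^ Suc N dvd (\<Sum>k\<in>K. c k * (\<Prod>v\<in>UNIV. (a v + s * y v) ^ e k v))"
proof -
  \<comment> \<open>An indeterminate stands in for the ring element \<open>s\<close>, so that
    vanishing coefficients yield divisibility; evaluation at \<open>s\<close> comes last.\<close>
  define q where "q = (\<Sum>k\<in>K. Polynomial.smult (c k) (\<Prod>v\<in>UNIV. [:a v, y v:] ^ e k v))"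
  have "Polynomial.coeff q i = 0" if "i < Suc N" for i
  proof -
    have "Polynomial.coeff q i = (\<Sum>k\<in>K. \<Sum>j | sum j UNIV = i. c k * (hasse j (e k) a * (\<Prod>v\<in>UNIV. y v ^ j v)))"
      by (simp add: q_def coeff_sum coeff_prod_linear_power sum_distrib_left)
    also have "\<dots> = (\<Sum>j | sum j UNIV = i. (\<Sum>k\<in>K. c k * hasse j (e k) a) * (\<Prod>v\<in>UNIV. y v ^ j v))"
      by (subst sum.swap) (simp add: sum_distrib_right mult.assoc)
    also have "\<dots> = 0"
    proof (rule sum.neutral, clarify)
      fix j :: "'v \<Rightarrow> nat" assume "i = sum j UNIV"
      then show "(\<Sum>k\<in>K. c k * hasse j (e k) a) * (\<Prod>v\<in>UNIV. y v ^ j v) = 0"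
        using hasse_vanish_lower[of K e d N c a j] deg \<open>N \<le> d\<close> top \<open>i < Suc N\<close> by simp
    qed
    finally show ?thesis .
  qed
  then have "Polynomial.monom 1 (Suc N) dvd q"
    by (simp add: monom_1_dvd_iff')
  then obtain g where "q = Polynomial.monom 1 (Suc N) * g" ..
  then have "poly q s = s ^ Suc N * poly g s"
    by (simp add: poly_monom)
  moreover have "poly q s = (\<Sum>k\<in>K. c k * (\<Prod>v\<in>UNIV. (a v + s * y v) ^ e k v))"
    by (simp add: q_def poly_sum poly_prod)
  ultimately show ?thesis by simp
qed

section \<open>Derivatives and Taylor expansion\<close>

text \<open>The factor is (e + t)! / e! in each variable, written with \<open>fact (t v)\<close>
  split off so that a divided derivative remains.\<close>

lemma lookup_pderiv_multi:
  fixes p :: "('v::finite, 'a::comm_ring_1) mpoly"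
  shows "Poly_Mapping.lookup (pderiv_multi t p) e =
    of_nat (\<Prod>v\<in>UNIV. fact (t v) * ((Poly_Mapping.lookup e v + t v) choose t v)) *
    Poly_Mapping.lookup p (e + Abs_poly_mapping t)"
proof (induction "sum t UNIV" arbitrary: t e)
  case 0
  then have "t = (\<lambda>_. 0)" by (simp add: fun_eq_iff)
  then show ?case by (simp add: pderiv_multi_0)
next
  case (Suc n)
  then obtain v where v: "t v \<noteq> 0"
    by (metis nat.distinct(1) sum.neutral)
  define u where "u = t(v := t v - 1)"
  have t: "t = u(v := Suc (u v))" using v by (auto simp: u_def)
  have n: "n = sum u UNIV" using Suc.hyps(2) by (simp add: t sum_fun_upd_Suc del: fun_upd_apply)
  let ?l = "Poly_Mapping.lookup" and ?s = "Poly_Mapping.single v (1::nat)"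
  let ?f = "\<lambda>t e v. fact (t v) * ((?l e v + t v) choose t v) :: nat"
  have shift: "e + Abs_poly_mapping t = e + ?s + Abs_poly_mapping u"
    by (rule poly_mapping_eqI) (auto simp: t lookup_add lookup_single when_def)
  \<comment> \<open>Multiplied by \<open>fact ?a\<close>, either side becomes
    \<open>fact (Suc ?a + ?b)\<close>.\<close>
  have fv: "Suc (?l e v) * ?f u (e + ?s) v = ?f t e v"
  proof -
    let ?a = "?l e v" and ?b = "u v"
    have "fact (Suc ?a) * (fact ?b * ((Suc ?a + ?b) choose ?b)) = (fact (Suc ?a + ?b) :: nat)"
      using binomial_fact_lemma[of ?b "Suc ?a + ?b"] by (simp add: ac_simps del: fact_Suc)
    moreover have "fact ?a * (fact (Suc ?b) * ((?a + Suc ?b) choose Suc ?b)) = (fact (Suc ?a + ?b) :: nat)"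
      using binomial_fact_lemma[of "Suc ?b" "?a + Suc ?b"] by (simp add: ac_simps del: fact_Suc)
    ultimately have "fact ?a * (Suc ?a * (fact ?b * ((Suc ?a + ?b) choose ?b))) =
        fact ?a * (fact (Suc ?b) * ((?a + Suc ?b) choose Suc ?b))"
      by (simp only: fact_Suc[of ?a] of_nat_id mult.assoc mult.left_commute)
    then have "Suc ?a * (fact ?b * ((Suc ?a + ?b) choose ?b)) = fact (Suc ?b) * ((?a + Suc ?b) choose Suc ?b)"
      by (simp only: mult_cancel1) simp
    moreover have "?l (e + ?s) v = Suc ?a" "t v = Suc ?b"
      by (simp_all add: lookup_add t)
    ultimately show ?thesis by simp
  qed
  have fw: "?f u (e + ?s) w = ?f t e w" if "w \<noteq> v" for w
    using that by (simp add: t lookup_add lookup_single)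
  have prods: "Suc (?l e v) * (\<Prod>w\<in>UNIV. ?f u (e + ?s) w) = (\<Prod>w\<in>UNIV. ?f t e w)"
  proof -
    have "(\<Prod>w\<in>UNIV. ?f u (e + ?s) w) = ?f u (e + ?s) v * (\<Prod>w\<in>UNIV - {v}. ?f u (e + ?s) w)"
      by (rule prod.remove) auto
    also have "(\<Prod>w\<in>UNIV - {v}. ?f u (e + ?s) w) = (\<Prod>w\<in>UNIV - {v}. ?f t e w)"
      by (rule prod.cong) (use fw in auto)
    finally have "Suc (?l e v) * (\<Prod>w\<in>UNIV. ?f u (e + ?s) w) =
        Suc (?l e v) * ?f u (e + ?s) v * (\<Prod>w\<in>UNIV - {v}. ?f t e w)"
      by (simp only: mult.assoc)
    also have "\<dots> = ?f t e v * (\<Prod>w\<in>UNIV - {v}. ?f t e w)"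
      by (simp only: fv)
    also have "\<dots> = (\<Prod>w\<in>UNIV. ?f t e w)"
      by (rule prod.remove[symmetric]) auto
    finally show ?thesis .
  qed
  have "?l (pderiv_multi t p) e = of_nat (Suc (?l e v)) * ?l (pderiv_multi u p) (e + ?s)"
    by (simp only: t pderiv_multi_Suc lookup_pderiv_var)
  also have "\<dots> = of_nat (Suc (?l e v) * (\<Prod>w\<in>UNIV. ?f u (e + ?s) w)) * ?l p (e + ?s + Abs_poly_mapping u)"
    by (simp only: Suc.hyps(1)[OF n] of_nat_mult mult.assoc)
  finally show ?case by (simp only: prods shift)
qed

text \<open>Differentiation lowers exponents by \<open>t\<close>; reindexing by this shift brings
  the sum back to the monomials of \<open>p\<close>.\<close>

lemma (in comm_ring_hom) eval_hom_pderiv_multi: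
  "eval_hom hom x (pderiv_multi t p) =
    of_nat (\<Prod>v\<in>UNIV. fact (t v)) *
    (\<Sum>e\<in>Poly_Mapping.keys p. hom (Poly_Mapping.lookup p e) * hasse t (Poly_Mapping.lookup e) x)"
proof -
  let ?l = "Poly_Mapping.lookup" and ?K = "Poly_Mapping.keys" and ?T = "Abs_poly_mapping t"
  let ?g = "\<lambda>e. hom (?l p e) * (of_nat (\<Prod>v\<in>UNIV. fact (t v)) * hasse t (?l e) x)"
  define A where "A = {e. e + ?T \<in> ?K p}"
  have inj: "inj_on (\<lambda>e. e + ?T) A" by (auto simp: inj_on_def)
  have img: "(\<lambda>e. e + ?T) ` A \<subseteq> ?K p" by (auto simp: A_def)
  have "finite A"
    using finite_imageD[OF finite_subset[OF img] inj] by simp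
  have "?K (pderiv_multi t p) \<subseteq> A"
    by (auto simp: A_def in_keys_iff lookup_pderiv_multi)
  then have "eval_hom hom x (pderiv_multi t p) =
      (\<Sum>e\<in>A. hom (?l (pderiv_multi t p) e) * (\<Prod>v\<in>UNIV. x v ^ ?l e v))"
    by (rule eval_hom_superset[OF \<open>finite A\<close>])
  also have "\<dots> = (\<Sum>e\<in>A. ?g (e + ?T))"
    by (rule sum.cong)
      (simp_all add: lookup_pderiv_multi lookup_add hasse_def hom_distribs hom_of_nat prod.distrib ac_simps)
  also have "\<dots> = sum ?g ((\<lambda>e. e + ?T) ` A)"
    by (simp add: sum.reindex[OF inj])
  also have "\<dots> = sum ?g (?K p)"
  proof (rule sum.mono_neutral_left[OF finite_keys img], clarify)
    fix e assume e: "e \<in> ?K p" "e \<notin> (\<lambda>e. e + ?T) ` A"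
    \<comment> \<open>Outside the image \<open>e\<close> is not bounded below by \<open>t\<close>,
      so the truncated subtraction loses something and some binomial in \<open>hasse\<close>
      vanishes.\<close>
    have "e \<noteq> (e - ?T) + ?T"
      using e by (auto simp: A_def)
    then obtain v where "?l e v < t v"
      by (auto simp: poly_mapping_eq_iff fun_eq_iff lookup_add lookup_minus)
        (metis le_add_diff_inverse2 not_le)
    then show "?g e = 0" by (simp add: hasse_eq_0)
  qed
  finally show ?thesis by (simp add: sum_distrib_left ac_simps)
qed

section \<open>Tangent forms as Taylor terms\<close>

lemma prod_mp_var: "(\<Prod>i\<in>UNIV. mp_var i ^ e i) = Poly_Mapping.single (Abs_poly_mapping e) (1 :: 'a::comm_ring_1)"
  for e :: "'v::finite \<Rightarrow> nat"
proof -
  have pow: "mp_var v ^ k = Poly_Mapping.single (Poly_Mapping.single v k) (1 :: 'a)" for v :: 'v and k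
    by (induction k) (simp_all add: mp_var_def mult_single single_add[symmetric])
  have prod: "(\<Prod>i\<in>A. Poly_Mapping.single (g i) (1 :: 'a)) = Poly_Mapping.single (\<Sum>i\<in>A. g i) 1"
    for g :: "'v \<Rightarrow> ('v \<Rightarrow>\<^sub>0 nat)" and A
    by (induction A rule: infinite_finite_induct) (simp_all add: mult_single)
  have "(\<Sum>i\<in>UNIV. Poly_Mapping.single i (e i)) = Abs_poly_mapping e"
    by (rule poly_mapping_eqI) (simp add: lookup_sum lookup_single when_def)
  then show ?thesis by (simp add: pow prod)
qed

lemma tangent_form_eq_sum_single:
  "tangent_form m H X = (\<Sum>j | sum j UNIV = m. Poly_Mapping.single (Abs_poly_mapping j)
     (1 / (\<Prod>i\<in>UNIV. fact (j i)) * mp_eval X (pderiv_multi j H)))"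
  by (simp add: tangent_form_def prod_mp_var mp_const_def mult_single)

lemma lookup_tangent_form:
  "sum j UNIV = m \<Longrightarrow> Poly_Mapping.lookup (tangent_form m H X) (Abs_poly_mapping j) =
     1 / (\<Prod>i\<in>UNIV. fact (j i)) * mp_eval X (pderiv_multi j H)"
proof -
  assume j: "sum j UNIV = m"
  have [simp]: "Abs_poly_mapping i = Abs_poly_mapping j \<longleftrightarrow> i = j" for i :: "'a \<Rightarrow> nat"
    by (simp add: poly_mapping_eq_iff)
  show ?thesis
    unfolding tangent_form_eq_sum_single
    by (simp add: lookup_sum lookup_single when_def finite_multi_indices j)
qed

text \<open>The factorials produced by the derivatives cancel those in the denominators of the
  tangent form. So \<open>tangent_form k\<close> is the Taylor term of degree \<open>k\<close> for
  every \<open>k\<close>, not only at the multiplicity.\<close>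

lemma coeff_eval_on_line:
  fixes H :: "('v::finite, 'a::field_char_0) mpoly"
  shows "Polynomial.coeff (eval_hom (\<lambda>c. [:c:]) (\<lambda>i. [:x i, y i:]) H) k = mp_eval y (tangent_form k H x)"
proof -
  let ?l = "Poly_Mapping.lookup"
  have nz: "(\<Prod>i\<in>UNIV. fact (j i)) \<noteq> (0::'a)" for j :: "'v \<Rightarrow> nat"
    by simp
  have "Polynomial.coeff (eval_hom (\<lambda>c. [:c:]) (\<lambda>i. [:x i, y i:]) H) k =
      (\<Sum>e\<in>Poly_Mapping.keys H. \<Sum>j | sum j UNIV = k. ?l H e * (hasse j (?l e) x * (\<Prod>v\<in>UNIV. y v ^ j v)))"
    by (simp add: eval_hom_def coeff_sum coeff_prod_linear_power sum_distrib_left)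
  also have "\<dots> = (\<Sum>j | sum j UNIV = k.
      (\<Sum>e\<in>Poly_Mapping.keys H. ?l H e * hasse j (?l e) x) * (\<Prod>v\<in>UNIV. y v ^ j v))"
    by (subst sum.swap) (simp add: sum_distrib_right mult.assoc)
  also have "\<dots> = mp_eval y (tangent_form k H x)"
    using nz by (simp add: tangent_form_eq_sum_single mp_eval_eq_eval_hom
        comm_ring_hom.eval_hom_sum[OF comm_ring_hom_id] comm_ring_hom.eval_hom_single[OF comm_ring_hom_id]
        comm_ring_hom.eval_hom_pderiv_multi[OF comm_ring_hom_id])
  finally show ?thesis .
qed

section \<open>Polynomial functions over infinite fields\<close>

text \<open>Induction on the set of variables. Agreement outside \<open>A\<close> ensures that
  distinct members of \<open>E\<close> give distinct monomials in the variables of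
  \<open>A\<close>.\<close>

lemma mpoly_function_zero:
  fixes c :: "('v \<Rightarrow> nat) \<Rightarrow> 'a::field_char_0"
  assumes "finite A" "finite E"
    and "\<forall>e\<in>E. \<forall>e'\<in>E. \<forall>v. v \<notin> A \<longrightarrow> e v = e' v"
    and "\<forall>x. (\<Sum>e\<in>E. c e * (\<Prod>v\<in>A. x v ^ e v)) = 0"
  shows "\<forall>e\<in>E. c e = 0"
  using assms
proof (induction A arbitrary: E rule: finite_induct)
  case empty
  show ?case
  proof
    fix e assume "e \<in> E"
    then have "E = {e}" using empty.prems(2) by (auto simp: fun_eq_iff)
    then show "c e = 0" using empty.prems(3) by simp
  qed
next
  case (insert v A)
  show ?case
  proof
    fix e assume "e \<in> E"
    let ?E = "{e' \<in> E. e' v = e v}"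
    have "(\<Sum>e'\<in>?E. c e' * (\<Prod>w\<in>A. x w ^ e' w)) = 0" for x
    proof -
      \<comment> \<open>Only the coordinate at \<open>v\<close> varies. As a polynomial in it,
        \<open>q\<close> vanishes on an infinite field, and its coefficient of degree
        \<open>e v\<close> is the sum over \<open>?E\<close>.\<close>
      define q where "q = (\<Sum>e'\<in>E. Polynomial.monom (c e' * (\<Prod>w\<in>A. x w ^ e' w)) (e' v))"
      have "poly q z = 0" for z
      proof -
        have "poly q z = (\<Sum>e'\<in>E. c e' * (\<Prod>w\<in>insert v A. (x(v := z)) w ^ e' w))"
          unfolding q_def poly_sum
        proof (rule sum.cong, rule refl)
          fix e' assume "e' \<in> E"
          have "(\<Prod>w\<in>A. (x(v := z)) w ^ e' w) = (\<Prod>w\<in>A. x w ^ e' w)"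
            by (rule prod.cong) (use insert.hyps in auto)
          then show "poly (Polynomial.monom (c e' * (\<Prod>w\<in>A. x w ^ e' w)) (e' v)) z =
              c e' * (\<Prod>w\<in>insert v A. (x(v := z)) w ^ e' w)"
            using insert.hyps by (simp add: poly_monom mult.assoc mult.commute[of "z ^ e' v"])
        qed
        then show ?thesis using insert.prems(3) by simp
      qed
      then have "q = 0" using poly_all_0_iff_0 by blast
      then have "Polynomial.coeff q (e v) = 0" by simp
      then show ?thesis
        using insert.prems(1) by (simp add: q_def coeff_sum sum.inter_filter)
    qed
    moreover have "\<forall>e1\<in>?E. \<forall>e2\<in>?E. \<forall>w. w \<notin> A \<longrightarrow> e1 w = e2 w"
    proof (intro ballI allI impI)
      fix e1 e2 w assume "e1 \<in> ?E" "e2 \<in> ?E" "w \<notin> A"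
      then show "e1 w = e2 w" using insert.prems(2) by (cases "w = v") auto
    qed
    moreover have "finite ?E"
      using insert.prems(1) by simp
    ultimately have "\<forall>e\<in>?E. c e = 0"
      using insert.IH[of ?E] by blast
    then show "c e = 0" using \<open>e \<in> E\<close> by simp
  qed
qed

lemma mp_eval_zero_imp_zero:
  fixes p :: "('v::finite, 'a::field_char_0) mpoly"
  assumes "\<And>x. mp_eval x p = 0"
  shows "p = 0"
proof -
  let ?l = "Poly_Mapping.lookup"
  let ?E = "?l ` Poly_Mapping.keys p"
  have inj: "inj_on ?l (Poly_Mapping.keys p)" by (simp add: inj_on_def)
  have "\<forall>e\<in>?E. ?l p (Abs_poly_mapping e) = 0"
  proof (rule mpoly_function_zero[where A = UNIV])
    show "\<forall>x. (\<Sum>e\<in>?E. ?l p (Abs_poly_mapping e) * (\<Prod>v\<in>UNIV. x v ^ e v)) = 0"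
      using assms by (simp add: sum.reindex[OF inj] mp_eval_def lookup_inverse)
  qed auto
  then have "?l p e = 0" for e
    by (auto simp: lookup_inverse in_keys_iff)
  then show ?thesis by (intro poly_mapping_eqI) simp
qed


section \<open>The interpolation determinant near the diagonal\<close>

text \<open>The cofactors of the last row are the coefficients of the form. They do not involve that
  row, so they pair equally well with any derivative row.\<close>

lemma power_dvd_det:
  fixes a y :: "'v::finite \<Rightarrow> 'b::{idom,ring_char_0}"
  assumes A: "A \<in> carrier_mat (Suc l) (Suc l)" and es: "length es = Suc l"
    and es_deg: "\<And>e. e \<in> set es \<Longrightarrow> sum e UNIV = d" and "N \<le> d"
    and ts: "length ts \<le> l" "{t. sum t UNIV = N} \<subseteq> set ts"
    and deriv: "\<And>i k. i < length ts \<Longrightarrow> k < Suc l \<Longrightarrow>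
      A $$ (i, k) = of_nat (\<Prod>v\<in>UNIV. fact ((ts ! i) v)) * hasse (ts ! i) (es ! k) a"
    and last: "\<And>k. k < Suc l \<Longrightarrow> A $$ (l, k) = (\<Prod>v\<in>UNIV. (a v + s * y v) ^ (es ! k) v)"
  shows "s ^ Suc N dvd det A"
proof -
  have "det A = (\<Sum>k<Suc l. A $$ (l, k) * cofactor A l k)"
    by (rule laplace_expansion_row[OF A]) simp
  also have "\<dots> = (\<Sum>k<Suc l. cofactor A l k * (\<Prod>v\<in>UNIV. (a v + s * y v) ^ (es ! k) v))"
    by (rule sum.cong) (simp_all add: last mult.commute)
  also have "s ^ Suc N dvd \<dots>"
  proof (rule power_dvd_form_on_line[OF _ \<open>N \<le> d\<close>])
    fix k assume "k \<in> {..<Suc l}"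
    then show "sum (es ! k) UNIV = d" using es es_deg by simp
  next
    fix t :: "'v \<Rightarrow> nat" assume "sum t UNIV = N"
    then obtain i where i: "i < length ts" "t = ts ! i"
      using ts(2) by (auto simp: in_set_conv_nth subset_iff)
    let ?c = "of_nat (\<Prod>v\<in>UNIV. fact (t v)) :: 'b"
    have "(A * adj_mat A) $$ (i, l) = 0"
      using i ts(1) by (simp add: adj_mat(2)[OF A])
    \<comment> \<open>Off-diagonal entry, since \<open>i < length ts \<le> l\<close>: it is the
      determinant with row \<open>i\<close> repeated in place of row \<open>l\<close>.\<close>
    moreover have "(A * adj_mat A) $$ (i, l) = (\<Sum>k<Suc l. A $$ (i, k) * cofactor A l k)"
      using A i ts(1) by (simp add: adj_mat_def scalar_prod_def lessThan_atLeast0)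
    moreover have "A $$ (i, k) * cofactor A l k = ?c * (cofactor A l k * hasse t (es ! k) a)"
      if "k < Suc l" for k
      unfolding deriv[OF i(1) that] i(2) by (simp only: ac_simps)
    ultimately have "(\<Sum>k<Suc l. ?c * (cofactor A l k * hasse t (es ! k) a)) = 0"
      by simp
    then have "?c * (\<Sum>k<Suc l. cofactor A l k * hasse t (es ! k) a) = 0"
      by (simp only: sum_distrib_left)
    moreover have "?c \<noteq> 0" by simp
    ultimately show "(\<Sum>k<Suc l. cofactor A l k * hasse t (es ! k) a) = 0"
      using mult_eq_0_iff by blast
  qed
  finally show ?thesis .
qed

lemma prod_UNIV_sum:
  fixes f :: "'v::finite + 'w::finite \<Rightarrow> 'c::comm_monoid_mult"
  shows "(\<Prod>v\<in>UNIV. f v) = (\<Prod>i\<in>UNIV. f (Inl i)) * (\<Prod>i\<in>UNIV. f (Inr i))"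
  using prod.Plus[of "UNIV :: 'v set" "UNIV :: 'w set" f] by (simp add: comp_def)

text \<open>Order and exponent are 0 on the \<open>Inr\<close> side, so every factor there is 1 and
  only the \<open>Inl\<close> variables remain.\<close>

lemma eval_hom_pderiv_multi_monomial:
  fixes h :: "'a::comm_ring_1 \<Rightarrow> 'b::comm_ring_1" and x :: "'n::finite + 'n \<Rightarrow> 'b"
  assumes "comm_ring_hom h"
  shows "eval_hom h x (pderiv_multi (case_sum t (\<lambda>_. 0)) (\<Prod>i\<in>UNIV. mp_var (Inl i) ^ e i)) =
    of_nat (\<Prod>i\<in>UNIV. fact (t i)) * hasse t e (\<lambda>i. x (Inl i))"
proof -
  interpret comm_ring_hom h by fact
  let ?e = "case_sum e (\<lambda>_. 0) :: 'n + 'n \<Rightarrow> nat"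
  have "(\<Prod>i\<in>UNIV. mp_var (Inl i) ^ e i) = (\<Prod>v\<in>UNIV. mp_var v ^ ?e v :: ('n + 'n, 'a) mpoly)"
    by (simp add: prod_UNIV_sum)
  also have "\<dots> = Poly_Mapping.single (Abs_poly_mapping ?e) 1"
    by (rule prod_mp_var)
  finally have monomial:
    "(\<Prod>i\<in>UNIV. mp_var (Inl i) ^ e i) = Poly_Mapping.single (Abs_poly_mapping ?e) (1 :: 'a)" .
  let ?t = "case_sum t (\<lambda>_. 0) :: 'n + 'n \<Rightarrow> nat"
  have "(\<Prod>v\<in>UNIV. fact (?t v)) = (\<Prod>i\<in>UNIV. fact (t i) :: nat)"
    by (simp only: prod_UNIV_sum sum.case fact_0 prod.neutral_const mult_1_right)
  moreover have "hasse ?t ?e x = hasse t e (\<lambda>i. x (Inl i))"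
    by (simp only: hasse_def prod_UNIV_sum sum.case binomial_n_0 of_nat_1 diff_self_eq_0 power_0
        mult_1_right prod.neutral_const)
  moreover have "(\<Sum>k\<in>Poly_Mapping.keys (Poly_Mapping.single (Abs_poly_mapping ?e) (1 :: 'a)).
      h (Poly_Mapping.lookup (Poly_Mapping.single (Abs_poly_mapping ?e) 1) k) * hasse ?t (Poly_Mapping.lookup k) x) =
      hasse ?t ?e x"
    by (simp del: of_nat_prod)
  ultimately show ?thesis
    by (simp only: monomial eval_hom_pderiv_multi)
qed

text \<open>Ring homomorphisms commute with \<open>det\<close>; on the entries, this one puts the
  derivative rows at \<open>a\<close> and the last row at \<open>a + s * y\<close>, as
  \<open>power_dvd_det\<close> requires.\<close>

lemma power_dvd_eval_det_interpolation_matrix: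
  fixes p :: "nat \<Rightarrow> 'n::finite \<Rightarrow> 'a::field_char_0" and h :: "'a \<Rightarrow> 'b::{idom,ring_char_0}"
  assumes h: "comm_ring_hom h"
    and es: "enumerates_multi_indices d es" and ts: "enumerates_multi_indices N ts" and "N \<le> d"
  shows "s ^ Suc N dvd
    eval_hom h (case_sum a (\<lambda>i. a i + s * y i)) (det (interpolation_matrix es ts r p))"
proof (cases "length es = length ts + r + 1")
  case False
  \<comment> \<open>The matrix is not square, so \<^const>\<open>det\<close> returns the junk value \<open>0\<close>.\<close>
  then have "det (interpolation_matrix es ts r p) = 0"
    by (simp add: det_def interpolation_matrix_def)
  then show ?thesis by (simp add: eval_hom_def)
next
  case True
  let ?x = "case_sum a (\<lambda>i. a i + s * y i)"
  let ?M = "interpolation_matrix es ts r p"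
  \<comment> \<open>Index of the last row, counted from 0: \<open>length ts\<close> derivative rows
    and \<open>r\<close> point rows precede it.\<close>
  let ?l = "length ts + r"
  interpret ev: comm_ring_hom "eval_hom h ?x"
    by (rule comm_ring_hom.comm_ring_hom_eval_hom[OF h])
  define R :: "('n + 'n, 'a) mpoly vec list" where "R = map (\<lambda>t. map_vec (pderiv_multi (case_sum t (\<lambda>_. 0)))
      (monomial_row es (\<lambda>i. mp_var (Inl i)))) ts
    @ map (\<lambda>k. monomial_row es (\<lambda>i. mp_const (p k i))) [1..<r + 1]"
  define z :: "('n + 'n, 'a) mpoly vec" where "z = monomial_row es (\<lambda>i. mp_var (Inr i))"
  have M: "?M = mat_of_rows (length es) (R @ [z])"
    by (simp only: interpolation_matrix_def R_def z_def append_assoc)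
  have len: "length R = ?l" by (simp add: R_def)
  have dims: "?M \<in> carrier_mat (Suc ?l) (Suc ?l)"
    using mat_of_rows_carrier(1)[of "length es" "R @ [z]"]
    by (simp only: M True length_append len list.size add_0_right add_Suc_right One_nat_def)
  have index: "?M $$ (i, k) = (R @ [z]) ! i $ k" if "i < Suc ?l" "k < Suc ?l" for i k
    unfolding M by (rule mat_of_rows_index) (use that True len in simp_all)
  have deriv: "?M $$ (i, k) =
      pderiv_multi (case_sum (ts ! i) (\<lambda>_. 0)) (\<Prod>v\<in>UNIV. mp_var (Inl v) ^ (es ! k) v)"
    if "i < length ts" "k < Suc ?l" for i k
  proof -
    have "(R @ [z]) ! i = map_vec (pderiv_multi (case_sum (ts ! i) (\<lambda>_. 0)))
        (monomial_row es (\<lambda>i. mp_var (Inl i)))"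
      using that(1) by (simp add: R_def nth_append)
    moreover have "k < length es" using that True by simp
    ultimately show ?thesis
      using index[of i k] that by (simp add: monomial_row_def)
  qed
  have last: "?M $$ (?l, k) = (\<Prod>v\<in>UNIV. mp_var (Inr v) ^ (es ! k) v)" if "k < Suc ?l" for k
  proof -
    have "(R @ [z]) ! ?l = z" by (metis len nth_append_length)
    moreover have "k < length es" using that True by simp
    ultimately show ?thesis
      using index[of ?l k] that by (simp add: z_def monomial_row_def)
  qed
  have "s ^ Suc N dvd det (map_mat (eval_hom h ?x) ?M)"
  proof (rule power_dvd_det[where l = ?l and es = es and ts = ts and d = d and a = a and y = y])
    show "map_mat (eval_hom h ?x) ?M \<in> carrier_mat (Suc ?l) (Suc ?l)"
      unfolding map_carrier_mat by (rule dims)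
    show "length es = Suc ?l" using True by simp
    show "length ts \<le> ?l" by simp
    show "N \<le> d" by fact
    show "sum e UNIV = d" if "e \<in> set es" for e
      using es that by (simp add: enumerates_multi_indices_def)
    show "{t. sum t UNIV = N} \<subseteq> set ts"
      using ts by (simp add: enumerates_multi_indices_def)
    show "map_mat (eval_hom h ?x) ?M $$ (i, k) =
        of_nat (\<Prod>v\<in>UNIV. fact ((ts ! i) v)) * hasse (ts ! i) (es ! k) a"
      if "i < length ts" "k < Suc ?l" for i k
    proof -
      have "map_mat (eval_hom h ?x) ?M $$ (i, k) = eval_hom h ?x (?M $$ (i, k))"
        by (rule index_map_mat(1)) (use dims that in auto)
      then show ?thesis
        by (simp only: deriv[OF that] eval_hom_pderiv_multi_monomial[OF h] sum.case)
    qed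
    show "map_mat (eval_hom h ?x) ?M $$ (?l, k) = (\<Prod>v\<in>UNIV. (a v + s * y v) ^ (es ! k) v)"
      if "k < Suc ?l" for k
    proof -
      have "map_mat (eval_hom h ?x) ?M $$ (?l, k) = eval_hom h ?x (?M $$ (?l, k))"
        by (rule index_map_mat(1)) (use dims that in auto)
      then show ?thesis
        by (simp only: last[OF that] ev.hom_prod ev.hom_power comm_ring_hom.eval_hom_var[OF h] sum.case)
    qed
  qed
  moreover have "det (map_mat (eval_hom h ?x) ?M) = eval_hom h ?x (det ?M)"
    by (rule ev.hom_det)
  ultimately show ?thesis by (rule subst[rotated])
qed

text \<open>
  In \<open>'a poly poly\<close> the inner variable is \<open>u\<close> and the outer one \<open>v\<close>, so the hypothesis says that
  \<open>(v - u)^m\<close> divides \<open>F(b + u y, b + v y)\<close>.  Setting \<open>u = 0\<close> or \<open>v = 0\<close> leaves \<open>v^m\<close> or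
  \<open>(-u)^m\<close> times a cofactor with the same constant term.
\<close>

lemma tangent_form_swap:
  fixes F :: "('n::finite + 'n, 'a::field_char_0) mpoly"
  assumes dvd: "\<And>y. [:[:0, -1:], [:1:]:] ^ m dvd eval_hom (\<lambda>c. [:[:c:]:])
      (case_sum (\<lambda>i. [:[:b i, y i:]:]) (\<lambda>i. [:[:b i:], [:y i:]:])) F"
    and "k \<le> m"
  shows "tangent_form k (mp_subst (case_sum mp_var (\<lambda>i. mp_const (b i))) F) b =
    mp_const ((-1) ^ k) * tangent_form k (mp_subst (case_sum (\<lambda>i. mp_const (b i)) mp_var) F) b"
    (is "tangent_form k ?R b = mp_const ((-1) ^ k) * tangent_form k ?L b")
    and "k < m \<Longrightarrow> tangent_form k (mp_subst (case_sum mp_var (\<lambda>i. mp_const (b i))) F) b = 0"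
proof -
  note const_var = comm_ring_hom.eval_hom_const[OF comm_ring_hom_pCons]
    comm_ring_hom.eval_hom_var[OF comm_ring_hom_pCons]
  have eval_outer: "comm_ring_hom (\<lambda>q :: 'a poly poly. poly q 0)"
    by unfold_locales simp_all
  interpret P: comm_ring_hom "\<lambda>q :: 'a poly. poly q 0"
    by unfold_locales simp_all
  interpret U: map_poly_comm_ring_hom "\<lambda>q :: 'a poly. poly q 0" ..
  \<comment> \<open>The outer constant term is -u and the outer linear coefficient 1, so this is v -
    u.\<close>
  let ?s = "[:[:0, -1:], [:1:]:] :: 'a poly poly"
  \<comment> \<open>The witness \<open>q0\<close> will be the value of the cofactor \<open>g\<close>
    at u = v = 0.\<close>
  have vals: "\<exists>q0. mp_eval y (tangent_form k ?L b) = (if k = m then q0 else 0) \<and>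
      mp_eval y (tangent_form k ?R b) = (if k = m then (-1) ^ m * q0 else 0)" for y
  proof -
    let ?x = "case_sum (\<lambda>i. [:[:b i, y i:]:]) (\<lambda>i. [:[:b i:], [:y i:]:])"
    obtain g where g: "eval_hom (\<lambda>c. [:[:c:]:]) ?x F = ?s ^ m * g"
      using dvd by blast
    have coeff: "Polynomial.coeff (Polynomial.monom c m * q) k = (if k = m then c * poly q 0 else 0)"
      for c :: 'a and q
      using \<open>k \<le> m\<close> by (simp add: coeff_monom_mult poly_0_coeff_0)
    have "eval_hom (\<lambda>c. [:c:]) (\<lambda>i. [:b i, y i:]) ?L =
        eval_hom (\<lambda>c. [:c:]) (case_sum (\<lambda>i. [:b i:]) (\<lambda>i. [:b i, y i:])) F"
      by (subst eval_hom_mp_subst[OF comm_ring_hom_pCons], rule arg_cong[where f = "\<lambda>x. eval_hom _ x F"])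
        (simp add: fun_eq_iff const_var split: sum.splits)
    \<comment> \<open>Evaluating the coefficients at 0 sets u = 0 and leaves a polynomial in v. For
      \<open>?R\<close> the outer variable is evaluated instead, which leaves a polynomial in
      u.\<close>
    also have "\<dots> = map_poly (\<lambda>q. poly q 0) (eval_hom (\<lambda>c. [:[:c:]:]) ?x F)"
      by (subst hom_eval_hom[OF U.comm_ring_hom_axioms], rule arg_cong2[where f = "\<lambda>h x. eval_hom h x F"])
        (simp_all add: fun_eq_iff Polynomial.map_poly_pCons split: sum.splits)
    also have "\<dots> = Polynomial.monom 1 m * map_poly (\<lambda>q. poly q 0) g"
      by (simp add: g U.hom_mult U.hom_power Polynomial.map_poly_pCons monom_altdef)
    finally have L: "mp_eval y (tangent_form k ?L b) = (if k = m then poly (poly g 0) 0 else 0)"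
      by (simp add: coeff_eval_on_line[symmetric] coeff poly_0_coeff_0 coeff_map_poly)
    have "eval_hom (\<lambda>c. [:c:]) (\<lambda>i. [:b i, y i:]) ?R =
        eval_hom (\<lambda>c. [:c:]) (case_sum (\<lambda>i. [:b i, y i:]) (\<lambda>i. [:b i:])) F"
      by (subst eval_hom_mp_subst[OF comm_ring_hom_pCons], rule arg_cong[where f = "\<lambda>x. eval_hom _ x F"])
        (simp add: fun_eq_iff const_var split: sum.splits)
    also have "\<dots> = poly (eval_hom (\<lambda>c. [:[:c:]:]) ?x F) 0"
      by (subst hom_eval_hom[OF eval_outer], rule arg_cong2[where f = "\<lambda>h x. eval_hom h x F"])
        (simp_all add: fun_eq_iff split: sum.splits)
    also have "\<dots> = [:0, -1:] ^ m * poly g 0"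
      by (simp add: g)
    also have "[:0, -1:] ^ m = Polynomial.monom ((-1) ^ m :: 'a) m"
      by (metis One_nat_def monom_0 monom_Suc monom_power mult.left_neutral pCons_0_0)
    finally have "mp_eval y (tangent_form k ?R b) = (if k = m then (-1) ^ m * poly (poly g 0) 0 else 0)"
      by (simp add: coeff_eval_on_line[symmetric] coeff)
    with L show ?thesis by blast
  qed
  \<comment> \<open>Equal values at every \<open>y\<close> are turned into equal polynomials. For
    \<open>k < m\<close> both forms vanish, so the sign matters only at
    \<open>k = m\<close>.\<close>
  let ?D = "tangent_form k ?R b + mp_const (- ((-1) ^ k)) * tangent_form k ?L b"
  have "mp_eval y ?D = 0" for y
    using vals[of y]
    by (auto simp: mp_eval_eq_eval_hom comm_ring_hom.eval_hom_add[OF comm_ring_hom_id]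
        comm_ring_hom.eval_hom_mult[OF comm_ring_hom_id] comm_ring_hom.eval_hom_const[OF comm_ring_hom_id]
        split: if_splits)
  then have "?D = 0" by (rule mp_eval_zero_imp_zero)
  moreover have "mp_const (- ((-1) ^ k)) = - (mp_const ((-1) ^ k) :: ('n, 'a) mpoly)"
    by (simp add: mp_const_def single_uminus)
  ultimately show "tangent_form k ?R b = mp_const ((-1) ^ k) * tangent_form k ?L b"
    by simp
  show "tangent_form k ?R b = 0" if "k < m"
    using vals that by (intro mp_eval_zero_imp_zero) (metis less_irrefl)
qed

section \<open>Multiplicity and tangent cones from tangent forms\<close>

text \<open>Distinct \<open>j\<close> give distinct monomials and the factorials are invertible, so
  the form of degree \<open>k\<close> vanishes exactly when all derivatives of order
  \<open>k\<close> do.\<close>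

lemma has_multiplicity_iff_tangent_form:
  "has_multiplicity H X m \<longleftrightarrow> (\<forall>k<m. tangent_form k H X = 0) \<and> tangent_form m H X \<noteq> 0"
proof -
  have "tangent_form k H X = 0 \<longleftrightarrow> (\<forall>j. sum j UNIV = k \<longrightarrow> mp_eval X (pderiv_multi j H) = 0)" for k
  proof
    assume 0: "tangent_form k H X = 0"
    show "\<forall>j. sum j UNIV = k \<longrightarrow> mp_eval X (pderiv_multi j H) = 0"
    proof clarify
      fix j :: "'a \<Rightarrow> nat" assume "k = sum j UNIV"
      then show "mp_eval X (pderiv_multi j H) = 0"
        using lookup_tangent_form[of j k H X] 0 by simp
    qed
  qed (simp add: tangent_form_eq_sum_single)
  then show ?thesis unfolding has_multiplicity_def by blast
qed

theorem corollary9: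
  fixes n d m r :: nat
    and Z :: "('n::finite \<Rightarrow> 'a::field_char_0) set set"
    and P :: "nat \<Rightarrow> ('n \<Rightarrow> 'a) set"
    and p :: "nat \<Rightarrow> 'n \<Rightarrow> 'a"
    and es ts :: "('n \<Rightarrow> nat) list"
    and B :: "('n \<Rightarrow> 'a) set"
    and b :: "'n \<Rightarrow> 'a"
    and F :: "('n + 'n, 'a) mpoly"
    and F\<^sub>L F\<^sub>R :: "('n, 'a) mpoly"
  assumes "CARD('n) = n + 1"
    and "Z \<subseteq> projective_space"
    and "bij_betw P {1..r} Z"
    and "\<And>i. i \<in> {1..r} \<Longrightarrow> p i \<in> P i"
    and "d > 0" and "m > 0"
    and "(d + n) choose n = ((m + n - 1) choose n) + r + 1"
    and "enumerates_multi_indices d es"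
    and "enumerates_multi_indices (m - 1) ts"
    and "F = det (interpolation_matrix es ts r p)"
    and "B \<in> projective_space" and "b \<in> B"
    and "F\<^sub>L = mp_subst (case_sum (\<lambda>i. mp_const (b i)) mp_var) F"
    and "F\<^sub>R = mp_subst (case_sum mp_var (\<lambda>i. mp_const (b i))) F"
    and "F\<^sub>L \<noteq> 0"
    and "has_multiplicity F\<^sub>L b m"
  shows "has_multiplicity F\<^sub>L b m \<and> has_multiplicity F\<^sub>R b m \<and>
    tangent_cone m F\<^sub>L b = tangent_cone m F\<^sub>R b"
proof -
  \<comment> \<open>If \<open>d < m\<close>, then \<open>d + n \<le> m + n - 1\<close>, and the
    derivative rows alone would be at least as many as the monomials.\<close>
  have "m \<le> d"
  proof (rule ccontr)
    assume "\<not> m \<le> d"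
    then have "(d + n) choose n \<le> (m + n - 1) choose n"
      by (intro binomial_right_mono) simp
    with assms(7) show False by simp
  qed
  have C: "comm_ring_hom (\<lambda>c :: 'a. [:[:c:]:])"
    by (rule comm_ring_hom_comp[OF comm_ring_hom_pCons comm_ring_hom_pCons])
  let ?s = "[:[:0, -1:], [:1:]:] :: 'a poly poly"
  \<comment> \<open>At \<open>a = b + u y\<close>, adding (v - u) y gives b + v y; the exponent
    arises as \<open>Suc (m - 1)\<close>.\<close>
  have dvd: "?s ^ m dvd eval_hom (\<lambda>c. [:[:c:]:])
      (case_sum (\<lambda>i. [:[:b i, y i:]:]) (\<lambda>i. [:[:b i:], [:y i:]:])) F" for y
    using power_dvd_eval_det_interpolation_matrix[OF C assms(8,9), where s = ?s
        and a = "\<lambda>i. [:[:b i, y i:]:]" and y = "\<lambda>i. [:[:y i:]:]" and r = r and p = p]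
      \<open>m \<le> d\<close> \<open>m > 0\<close> assms(10) by simp
  note swap = tangent_form_swap[where F = F and b = b, OF dvd, folded assms(13,14)]
  \<comment> \<open>The sign is its own inverse, so each tangent form divides the other and they
    generate the same ideal.\<close>
  have sign: "mp_const ((-1) ^ m) * mp_const ((-1) ^ m) = (1 :: ('n, 'a) mpoly)"
    by (simp add: mp_const_def mult_single power_add[symmetric] flip: mult_2)
  have R: "tangent_form m F\<^sub>R b = mp_const ((-1) ^ m) * tangent_form m F\<^sub>L b"
    by (rule swap(1)) simp
  then have L: "tangent_form m F\<^sub>L b = mp_const ((-1) ^ m) * tangent_form m F\<^sub>R b"
    by (simp add: mult.assoc[symmetric] sign)
  have "tangent_form m F\<^sub>R b \<noteq> 0"
    using assms(16) L unfolding has_multiplicity_iff_tangent_form by force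
  moreover have "tangent_form k F\<^sub>R b = 0" if "k < m" for k
    by (rule swap(2)) (use that in simp_all)
  ultimately have "has_multiplicity F\<^sub>R b m"
    unfolding has_multiplicity_iff_tangent_form by blast
  moreover have "tangent_cone m F\<^sub>L b = tangent_cone m F\<^sub>R b"
  proof -
    have "tangent_form m F\<^sub>L b dvd tangent_form m F\<^sub>R b"
      using R by (rule dvdI[OF trans[OF _ mult.commute]])
    moreover have "tangent_form m F\<^sub>R b dvd tangent_form m F\<^sub>L b"
      using L by (rule dvdI[OF trans[OF _ mult.commute]])
    ultimately show ?thesis
      unfolding tangent_cone_def hypersurface_def by (blast intro: dvd_trans)
  qed
  ultimately show ?thesis using assms(16) by blast
qed

end
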